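(* $k_0(c_0) \le 6+4\sqrt{2}$.
   Context: $c_0$ is the Banach space of real sequences $x=(x_n)_{n\ge1}$ converging to $0$, with the norm $\|x\|=\sup_n|x_n|$. For a Banach space $X$, $B_X=\{x\in X:\|x\|\le 1\}$ denotes the (closed) unit ball and $S_X=\{x\in X:\|x\|=1\}$ the unit sphere. A retraction $R:B_X\to S_X$ is a map with $R(x)=x$ for all $x\in S_X$; it is $k$-Lipschitz if $\|R(x)-R(y)\|\le k\|x-y\|$ for all $x,y\in B_X$. For an infinite-dimensional Banach space $X$, $$k_0(X) := \inf\{k>0 : \text{there exists a } k\text{-Lipschitz retraction } R:B_X\to S_X\}.$$ *)

theory Defs
  imports "HOL-Analysis.Analysis"
begin

text \<open>
  The Banach space of real null sequences. Sequences are indexed by \<^typ>\<open>nat\<close>, so the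
  paper's \<open>n\<close>-th entry (with \<open>n \<ge> 1\<close>) is the entry with index \<open>n - 1\<close> here.
\<close>

typedef c0 = "{x :: nat \<Rightarrow> real. x \<longlonglongrightarrow> 0}"
  morphisms c0_nth Abs_c0
  by (rule exI[of _ "\<lambda>_. 0"]) simp

setup_lifting type_definition_c0

lemma c0_nth_tendsto: "c0_nth x \<longlonglongrightarrow> 0"
  using c0_nth[of x] by simp

lemma c0_eqI: "(\<And>n. c0_nth x n = c0_nth y n) \<Longrightarrow> x = y"
  by (simp add: c0_nth_inject[symmetric] ext)

instantiation c0 :: real_vector
begin

lift_definition zero_c0 :: c0 is "\<lambda>_. 0" by simp
lift_definition plus_c0 :: "c0 \<Rightarrow> c0 \<Rightarrow> c0" is "\<lambda>x y n. x n + y n"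
  by (auto intro: tendsto_add_zero)
lift_definition uminus_c0 :: "c0 \<Rightarrow> c0" is "\<lambda>x n. - x n"
  using tendsto_minus[of _ 0] by simp
lift_definition minus_c0 :: "c0 \<Rightarrow> c0 \<Rightarrow> c0" is "\<lambda>x y n. x n - y n"
  using tendsto_diff[of _ 0 _ _ 0] by simp
lift_definition scaleR_c0 :: "real \<Rightarrow> c0 \<Rightarrow> c0" is "\<lambda>r x n. r * x n"
  by (auto intro: tendsto_mult_right_zero)

instance
  by standard (transfer; simp add: algebra_simps fun_eq_iff)+

end

lemmas c0_nth_simps [simp] =
  zero_c0.rep_eq plus_c0.rep_eq uminus_c0.rep_eq minus_c0.rep_eq scaleR_c0.rep_eq

lemma bdd_above_c0: "bdd_above (range (\<lambda>n. \<bar>c0_nth x n\<bar>))"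
proof -
  have "Bseq (c0_nth x)"
    using c0_nth_tendsto[of x] by (intro convergent_imp_Bseq) (auto simp: convergent_def)
  then obtain K where "\<And>n. \<bar>c0_nth x n\<bar> \<le> K"
    by (auto simp: Bseq_def)
  then show ?thesis
    by (auto intro: bdd_aboveI[of _ K])
qed

instantiation c0 :: real_normed_vector
begin

definition norm_c0 :: "c0 \<Rightarrow> real"
  where "norm_c0 x = (SUP n. \<bar>c0_nth x n\<bar>)"

definition dist_c0 :: "c0 \<Rightarrow> c0 \<Rightarrow> real"
  where "dist_c0 x y = norm (x - y)"

definition sgn_c0 :: "c0 \<Rightarrow> c0"
  where "sgn_c0 x = x /\<^sub>R norm x"

definition uniformity_c0 :: "(c0 \<times> c0) filter"
  where "uniformity_c0 = (INF e\<in>{0 <..}. principal {(x, y). dist x y < e})"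

definition open_c0 :: "c0 set \<Rightarrow> bool"
  where "open_c0 S = (\<forall>x\<in>S. \<forall>\<^sub>F (x', y) in uniformity. x' = x \<longrightarrow> y \<in> S)"

instance
proof
  have le: "\<bar>c0_nth x n\<bar> \<le> norm x" for x n
    unfolding norm_c0_def by (intro cSUP_upper bdd_above_c0) simp
  have leI: "norm x \<le> b" if "\<And>n. \<bar>c0_nth x n\<bar> \<le> b" for x b
    unfolding norm_c0_def using that by (intro cSUP_least) auto
  fix x y :: c0 and r :: real
  show "norm x = 0 \<longleftrightarrow> x = 0"
  proof
    assume "norm x = 0"
    then have "c0_nth x n = 0" for n
      using le[of x n] by simp
    then show "x = 0"
      by (intro c0_eqI) simp
  qed (simp add: norm_c0_def)
  show "norm (x + y) \<le> norm x + norm y"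
  proof (rule leI)
    fix n
    show "\<bar>c0_nth (x + y) n\<bar> \<le> norm x + norm y"
      using le[of x n] le[of y n] by simp
  qed
  have scale_le: "norm (r *\<^sub>R x) \<le> \<bar>r\<bar> * norm x" for r and x :: c0
    by (rule leI) (simp add: abs_mult mult_left_mono le)
  show "norm (r *\<^sub>R x) = \<bar>r\<bar> * norm x"
  proof (cases "r = 0")
    case True
    then show ?thesis by (simp add: norm_c0_def)
  next
    case False
    have "norm x \<le> \<bar>inverse r\<bar> * norm (r *\<^sub>R x)"
      using scale_le[of "inverse r" "r *\<^sub>R x"] False by simp
    then have "\<bar>r\<bar> * norm x \<le> norm (r *\<^sub>R x)"
      using False by (simp add: field_simps)
    with scale_le[of r x] show ?thesis by simp
  qed
qed (simp_all only: dist_c0_def sgn_c0_def uniformity_c0_def open_c0_def)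

end

lemma abs_c0_nth_le_norm: "\<bar>c0_nth x n\<bar> \<le> norm x"
  unfolding norm_c0_def by (intro cSUP_upper bdd_above_c0) simp

lemma norm_c0_leI: "(\<And>n. \<bar>c0_nth x n\<bar> \<le> b) \<Longrightarrow> norm x \<le> b"
  unfolding norm_c0_def by (intro cSUP_least) auto

instance c0 :: banach
proof
  fix X :: "nat \<Rightarrow> c0"
  assume X: "Cauchy X"
  have "Cauchy (\<lambda>k. c0_nth (X k) n)" for n
  proof (rule metric_CauchyI)
    fix e :: real
    assume "0 < e"
    with X obtain M where M: "\<And>k l. k \<ge> M \<Longrightarrow> l \<ge> M \<Longrightarrow> norm (X k - X l) < e"
      by (meson CauchyD)
    have "dist (c0_nth (X k) n) (c0_nth (X l) n) < e" if "k \<ge> M" "l \<ge> M" for k l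
      using abs_c0_nth_le_norm[of "X k - X l" n] M[OF that] by (simp add: dist_real_def)
    then show "\<exists>M. \<forall>k\<ge>M. \<forall>l\<ge>M. dist (c0_nth (X k) n) (c0_nth (X l) n) < e"
      by blast
  qed
  then have "\<exists>l. (\<lambda>k. c0_nth (X k) n) \<longlonglongrightarrow> l" for n
    by (simp add: Cauchy_convergent flip: convergent_def)
  then obtain L where L: "\<And>n. (\<lambda>k. c0_nth (X k) n) \<longlonglongrightarrow> L n"
    using choice[of "\<lambda>n l. (\<lambda>k. c0_nth (X k) n) \<longlonglongrightarrow> l"] by blast
  have unif: "\<exists>M. \<forall>k\<ge>M. \<forall>n. \<bar>c0_nth (X k) n - L n\<bar> \<le> e" if "0 < e" for e
  proof -
    from X that obtain M where M: "\<And>k l. k \<ge> M \<Longrightarrow> l \<ge> M \<Longrightarrow> norm (X k - X l) < e"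
      by (meson CauchyD)
    have "\<bar>c0_nth (X k) n - L n\<bar> \<le> e" if "k \<ge> M" for k n
    proof (rule LIMSEQ_le_const2)
      show "(\<lambda>l. \<bar>c0_nth (X k) n - c0_nth (X l) n\<bar>) \<longlonglongrightarrow> \<bar>c0_nth (X k) n - L n\<bar>"
        by (intro tendsto_intros L)
      have "\<bar>c0_nth (X k) n - c0_nth (X l) n\<bar> \<le> e" if "l \<ge> M" for l
        using abs_c0_nth_le_norm[of "X k - X l" n] M[OF \<open>k \<ge> M\<close> that] by simp
      then show "\<exists>N. \<forall>l\<ge>N. \<bar>c0_nth (X k) n - c0_nth (X l) n\<bar> \<le> e"
        by blast
    qed
    then show ?thesis by blast
  qed
  have "L \<longlonglongrightarrow> 0"
  proof (rule LIMSEQ_I)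
    fix e :: real
    assume e: "0 < e"
    with unif[of "e / 2"] obtain k where k: "\<And>n. \<bar>c0_nth (X k) n - L n\<bar> \<le> e / 2"
      by auto
    from LIMSEQ_D[OF c0_nth_tendsto[of "X k"], of "e / 2"] e
    obtain N where N: "\<And>n. n \<ge> N \<Longrightarrow> \<bar>c0_nth (X k) n\<bar> < e / 2"
      by auto
    have "norm (L n - 0) < e" if "n \<ge> N" for n
      using k[of n] N[OF that] by (simp add: abs_if split: if_splits)
    then show "\<exists>N. \<forall>n\<ge>N. norm (L n - 0) < e"
      by blast
  qed
  then have L_nth: "c0_nth (Abs_c0 L) = L"
    by (simp add: Abs_c0_inverse)
  have "X \<longlonglongrightarrow> Abs_c0 L"
  proof (rule LIMSEQ_I)
    fix e :: real
    assume e: "0 < e"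
    with unif[of "e / 2"] obtain M where M: "\<And>k n. k \<ge> M \<Longrightarrow> \<bar>c0_nth (X k) n - L n\<bar> \<le> e / 2"
      by auto
    have "norm (X k - Abs_c0 L) < e" if "k \<ge> M" for k
    proof -
      have "norm (X k - Abs_c0 L) \<le> e / 2"
        using M[OF that] by (intro norm_c0_leI) (simp add: L_nth)
      with e show ?thesis by simp
    qed
    then show "\<exists>M. \<forall>k\<ge>M. norm (X k - Abs_c0 L) < e"
      by blast
  qed
  then show "convergent X"
    by (auto simp: convergent_def)
qed

text \<open>
  The infimum is taken in \<^typ>\<open>ereal\<close>, so that it is \<open>\<infinity>\<close> if there is no Lipschitz retraction
  at all (which is the case for finite-dimensional spaces).
\<close>

definition k0 :: "'a::banach itself \<Rightarrow> ereal"
  where "k0 _ = Inf (ereal ` {k. k > 0 \<and>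
    (\<exists>R :: 'a \<Rightarrow> 'a. retraction (cball 0 1) (sphere 0 1) R \<and> k-lipschitz_on (cball 0 1) R)})"

end

theory Submission
  imports Defs
begin

text \<open>
  There is even a \<open>7\<close>-Lipschitz retraction of the unit ball of \<open>c\<^sub>0\<close> onto its unit sphere, and
  \<open>7 \<le> 6 + 4 * sqrt 2\<close>.

  The lattice structure of \<open>c\<^sub>0\<close> reduces the problem to a scalar one. Clipping all entries to
  \<open>[-1, 1]\<close> is \<open>1\<close>-Lipschitz and sends every sequence of norm at least \<open>1\<close> to the sphere, so it
  suffices to find a Lipschitz map \<open>F\<close> into \<open>{y. norm y \<ge> 1}\<close> that fixes the sphere. Look for it in
  the form \<open>F x n = profile (norm x) (x (n - 1)) (x n)\<close>, with the constant \<open>1\<close> in place of the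
  missing entry \<open>x (-1)\<close>. Entries and norm move by at most \<open>norm (x - y)\<close> when \<open>x\<close> is replaced by
  \<open>y\<close>, hence a Lipschitz constant of the scalar function \<open>profile\<close> for the maximum distance on
  \<open>\<real>\<^sup>3\<close> is one for \<open>F\<close>; and \<open>profile s 0 0 = 0\<close> makes \<open>F x\<close> a null sequence.

  Two different reasons give \<open>F x\<close> an entry of modulus at least \<open>1\<close>. If \<open>norm x \<ge> 4/5\<close>, it is the
  entry at which \<open>x\<close> attains its norm: \<open>profile\<close> stretches \<open>\<plusminus>s\<close> to at least \<open>1\<close> in modulus
  (\<open>profile_at_norm\<close>). If \<open>norm x \<le> 4/5\<close>, it comes from a domino effect: \<open>profile s v u \<le> -1\<close>
  whenever \<open>u \<le> 1/5 \<le> v\<close> (\<open>profile_domino\<close>), so if all entries of \<open>F x\<close> had modulus below \<open>1\<close>,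
  then the fictitious entry \<open>1\<close> would force \<open>x 0 > 1/5\<close>, this would force \<open>x 1 > 1/5\<close>, and so on,
  which is impossible for a null sequence. At \<open>norm x = 4/5\<close> the two requirements are compatible,
  because \<open>u = 4/5\<close> and \<open>u \<le> 1/5\<close> are far enough apart for a slope of \<open>7\<close>.
\<close>

section \<open>The scalar profile\<close>

text \<open>
  The innermost term \<open>u - 6 * max 0 (min (1 - s) v)\<close> is \<open>u\<close> for \<open>s = 1\<close> and drops to \<open>-1\<close>
  or lower in the domino situation. The two other terms are obstacles: for \<open>s \<ge> 4/5\<close> they keep the
  value above or at \<open>1\<close> if \<open>u = s\<close>, and below or at \<open>-1\<close> if \<open>u = -s\<close>. They depend on \<open>s\<close> only through \<open>max s (4/5)\<close>, so that
  they do not interfere with the domino effect on the smaller spheres.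
\<close>

definition profile :: "real \<Rightarrow> real \<Rightarrow> real \<Rightarrow> real"
  where "profile s v u =
    max (1 - 7 / 2 * (max s (4 / 5) - u))
      (min (7 / 2 * (max s (4 / 5) + u) - 1)
        (u - 6 * max 0 (min (1 - s) v)))"

lemma abs_max_diff_le:
  fixes a b c d e :: real
  assumes "\<bar>a - c\<bar> \<le> e" "\<bar>b - d\<bar> \<le> e"
  shows "\<bar>max a b - max c d\<bar> \<le> e"
  using assms by linarith

lemma abs_min_diff_le:
  fixes a b c d e :: real
  assumes "\<bar>a - c\<bar> \<le> e" "\<bar>b - d\<bar> \<le> e"
  shows "\<bar>min a b - min c d\<bar> \<le> e"
  using assms by linarith

text \<open>
  Each of the three terms spends its slope \<open>7\<close> differently: the obstacles as \<open>7/2 + 7/2\<close> on \<open>s\<close> and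
  \<open>u\<close>, the innermost term as \<open>1\<close> on \<open>u\<close> and \<open>6\<close> on whichever of \<open>s\<close> and \<open>v\<close> is active.
\<close>

lemma profile_lipschitz:
  assumes s: "\<bar>s - s'\<bar> \<le> e" and v: "\<bar>v - v'\<bar> \<le> e" and u: "\<bar>u - u'\<bar> \<le> e"
  shows "\<bar>profile s v u - profile s' v' u'\<bar> \<le> 7 * e"
proof -
  define \<sigma> \<sigma>' where "\<sigma> = max s (4 / 5)" and "\<sigma>' = max s' (4 / 5)"
  define m m' where "m = max 0 (min (1 - s) v)" and "m' = max 0 (min (1 - s') v')"
  have \<sigma>: "\<bar>\<sigma> - \<sigma>'\<bar> \<le> e"
    unfolding \<sigma>_def \<sigma>'_def using s by (intro abs_max_diff_le) auto
  have m: "\<bar>m - m'\<bar> \<le> e"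
    unfolding m_def m'_def using s v by (intro abs_max_diff_le abs_min_diff_le) auto
  have "\<bar>(1 - 7 / 2 * (\<sigma> - u)) - (1 - 7 / 2 * (\<sigma>' - u'))\<bar> \<le> 7 * e"
    "\<bar>(7 / 2 * (\<sigma> + u) - 1) - (7 / 2 * (\<sigma>' + u') - 1)\<bar> \<le> 7 * e"
    "\<bar>(u - 6 * m) - (u' - 6 * m')\<bar> \<le> 7 * e"
    using \<sigma> m u unfolding abs_le_iff by (simp_all add: field_simps)
  then show ?thesis
    unfolding profile_def \<sigma>_def \<sigma>'_def m_def m'_def
    by (intro abs_max_diff_le abs_min_diff_le)
qed

lemma profile_zero [simp]: "profile s 0 0 = 0"
  by (simp add: profile_def)

lemma profile_on_sphere:
  assumes "\<bar>u\<bar> \<le> 1"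
  shows "profile 1 v u = u"
proof -
  have "1 - 7 / 2 * (1 - u) \<le> u" "u \<le> 7 / 2 * (1 + u) - 1"
    using assms unfolding abs_le_iff by (simp_all add: field_simps)
  then show ?thesis
    by (simp add: profile_def max_absorb2 min_absorb2)
qed

lemma profile_at_norm:
  assumes "4 / 5 \<le> s" "\<bar>u\<bar> = s"
  shows "1 \<le> \<bar>profile s v u\<bar>"
proof (cases "0 \<le> u")
  case True
  with assms have "1 \<le> profile s v u"
    by (simp add: profile_def)
  then show ?thesis
    by simp
next
  case False
  with assms have "profile s v u \<le> - 1"
    by (simp add: profile_def min.coboundedI1)
  then show ?thesis
    by simp
qed

text \<open>
  For \<open>s \<le> 4/5\<close> and \<open>v \<ge> 1/5\<close> the innermost term is at most \<open>u - 6/5\<close>, which is why the threshold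
  \<open>1/5\<close> reproduces itself.
\<close>

lemma profile_domino:
  assumes "s \<le> 4 / 5" "1 / 5 \<le> v" "u \<le> 1 / 5"
  shows "profile s v u \<le> - 1"
proof -
  have "1 / 5 \<le> max 0 (min (1 - s) v)"
    using assms by auto
  then have "u - 6 * max 0 (min (1 - s) v) \<le> - 1"
    using mult_left_mono[of "1 / 5" "max 0 (min (1 - s) v)" 6] assms(3) by simp
  with assms show ?thesis
    by (simp add: profile_def max_absorb2 min.coboundedI2)
qed

section \<open>The retraction\<close>

lemma c0_norm_attained: "\<exists>n. \<bar>c0_nth x n\<bar> = norm x"
proof (rule ccontr)
  assume "\<nexists>n. \<bar>c0_nth x n\<bar> = norm x"
  then have less: "\<bar>c0_nth x n\<bar> < norm x" for n
    using abs_c0_nth_le_norm[of x n] by (metis less_le)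
  then have pos: "0 < norm x"
    by (meson abs_ge_zero le_less_trans)
  obtain N where N: "\<And>n. n \<ge> N \<Longrightarrow> \<bar>c0_nth x n\<bar> < norm x / 2"
    using LIMSEQ_D[OF c0_nth_tendsto[of x], of "norm x / 2"] pos by auto
  define M where "M = Max (insert (norm x / 2) ((\<lambda>n. \<bar>c0_nth x n\<bar>) ` {..<N}))"
  have "\<bar>c0_nth x n\<bar> \<le> M" for n
  proof (cases "n < N")
    case True
    then show ?thesis
      unfolding M_def by (intro Max_ge) auto
  next
    case False
    have "norm x / 2 \<le> M"
      unfolding M_def by (intro Max_ge) auto
    with N[of n] False show ?thesis
      by simp
  qed
  then have "norm x \<le> M"
    by (rule norm_c0_leI)
  moreover have "M < norm x"
    unfolding M_def using less pos by (subst Max_less_iff) auto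
  ultimately show False
    by simp
qed

text \<open>The value at \<open>0\<close> may be any constant that is at least the domino threshold \<open>1/5\<close>.\<close>

definition previous :: "c0 \<Rightarrow> nat \<Rightarrow> real"
  where "previous x n = (case n of 0 \<Rightarrow> 1 | Suc m \<Rightarrow> c0_nth x m)"

definition clip :: "real \<Rightarrow> real"
  where "clip t = max (- 1) (min 1 t)"

lemma abs_clip_le: "\<bar>clip t\<bar> \<le> \<bar>t\<bar>"
  by (simp add: clip_def max_def min_def)

definition retract_entry :: "c0 \<Rightarrow> nat \<Rightarrow> real"
  where "retract_entry x n = clip (profile (norm x) (previous x n) (c0_nth x n))"

definition sphere_retract :: "c0 \<Rightarrow> c0"
  where "sphere_retract x = Abs_c0 (retract_entry x)"

lemma retract_entry_tendsto: "retract_entry x \<longlonglongrightarrow> 0"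
proof (rule Lim_null_comparison)
  have "previous x \<longlonglongrightarrow> 0"
    by (rule LIMSEQ_imp_Suc) (simp add: previous_def c0_nth_tendsto)
  then show "(\<lambda>n. 7 * max \<bar>previous x n\<bar> \<bar>c0_nth x n\<bar>) \<longlonglongrightarrow> 0"
    using c0_nth_tendsto[of x]
    by (intro tendsto_mult_right_zero tendsto_eq_intros tendsto_max[of _ 0 _ _ 0, simplified]
        tendsto_rabs_zero)
  have "\<bar>retract_entry x n\<bar> \<le> 7 * max \<bar>previous x n\<bar> \<bar>c0_nth x n\<bar>" for n
    using profile_lipschitz[of "norm x" "norm x" "max \<bar>previous x n\<bar> \<bar>c0_nth x n\<bar>"
        "previous x n" 0 "c0_nth x n" 0]
      abs_clip_le[of "profile (norm x) (previous x n) (c0_nth x n)"]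
    by (auto simp: retract_entry_def le_max_iff_disj)
  then show "\<forall>\<^sub>F n in sequentially. norm (retract_entry x n)
      \<le> 7 * max \<bar>previous x n\<bar> \<bar>c0_nth x n\<bar>"
    by simp
qed

lemma sphere_retract_nth: "c0_nth (sphere_retract x) = retract_entry x"
  by (simp add: sphere_retract_def Abs_c0_inverse retract_entry_tendsto)

lemma sphere_retract_lipschitz: "7-lipschitz_on X sphere_retract"
proof (rule lipschitz_onI)
  fix x y :: c0
  have entry: "\<bar>c0_nth x n - c0_nth y n\<bar> \<le> norm (x - y)" for n
    using abs_c0_nth_le_norm[of "x - y" n] by simp
  show "dist (sphere_retract x) (sphere_retract y) \<le> 7 * dist x y"
    unfolding dist_norm
  proof (rule norm_c0_leI)
    fix n
    have "\<bar>previous x n - previous y n\<bar> \<le> norm (x - y)"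
      using entry by (simp add: previous_def split: nat.split)
    then have "\<bar>profile (norm x) (previous x n) (c0_nth x n)
        - profile (norm y) (previous y n) (c0_nth y n)\<bar> \<le> 7 * norm (x - y)"
      by (intro profile_lipschitz norm_triangle_ineq3 entry)
    then have "\<bar>retract_entry x n - retract_entry y n\<bar> \<le> 7 * norm (x - y)"
      unfolding retract_entry_def clip_def by (intro abs_max_diff_le abs_min_diff_le) auto
    then show "\<bar>c0_nth (sphere_retract x - sphere_retract y) n\<bar> \<le> 7 * norm (x - y)"
      by (simp add: sphere_retract_nth)
  qed
qed simp

lemma sphere_retract_fixes_sphere:
  assumes "norm x = 1"
  shows "sphere_retract x = x"
proof (rule c0_eqI)
  fix n
  have "\<bar>c0_nth x n\<bar> \<le> 1"
    using abs_c0_nth_le_norm[of x n] assms by simp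
  then show "c0_nth (sphere_retract x) n = c0_nth x n"
    by (simp add: sphere_retract_nth retract_entry_def assms profile_on_sphere clip_def abs_le_iff)
qed

lemma profile_large_entry:
  "\<exists>n. 1 \<le> \<bar>profile (norm x) (previous x n) (c0_nth x n)\<bar>"
proof (cases "4 / 5 \<le> norm x")
  case True
  then show ?thesis
    using c0_norm_attained[of x] profile_at_norm by blast
next
  case False
  show ?thesis
  proof (rule ccontr)
    assume "\<not> ?thesis"
    then have small: "\<not> profile (norm x) (previous x n) (c0_nth x n) \<le> - 1" for n
      by (auto simp: not_le abs_less_iff dest: spec[of _ n])
    have step: "1 / 5 < c0_nth x n" if "1 / 5 \<le> previous x n" for n
      using profile_domino[of "norm x" "previous x n" "c0_nth x n"] small[of n] that False
      by linarith
    (* The domino effect, started by the fictitious entry 1. *)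
    have "1 / 5 < c0_nth x n" for n
    proof (induction n)
      case 0
      show ?case
        by (rule step) (simp add: previous_def)
    next
      case (Suc n)
      then show ?case
        by (intro step) (simp add: previous_def)
    qed
    then have "1 / 5 \<le> (0 :: real)"
      by (intro LIMSEQ_le_const[OF c0_nth_tendsto[of x]]) (auto intro: less_imp_le)
    then show False
      by simp
  qed
qed

lemma norm_sphere_retract: "norm (sphere_retract x) = 1"
proof (rule antisym)
  show "norm (sphere_retract x) \<le> 1"
    by (rule norm_c0_leI) (simp add: sphere_retract_nth retract_entry_def clip_def)
  obtain n where "1 \<le> \<bar>profile (norm x) (previous x n) (c0_nth x n)\<bar>"
    using profile_large_entry by blast
  then have "1 \<le> \<bar>c0_nth (sphere_retract x) n\<bar>"
    by (auto simp: sphere_retract_nth retract_entry_def clip_def)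
  also have "\<dots> \<le> norm (sphere_retract x)"
    by (rule abs_c0_nth_le_norm)
  finally show "1 \<le> norm (sphere_retract x)" .
qed

lemma sphere_retract_retraction: "retraction (cball 0 1) (sphere 0 1) sphere_retract"
  unfolding retraction_def
  by (auto simp: norm_sphere_retract sphere_retract_fixes_sphere
      intro: lipschitz_on_continuous_on[OF sphere_retract_lipschitz])

theorem theorem3p3:
  shows "k0 TYPE(c0) \<le> ereal (6 + 4 * sqrt 2)"
proof -
  have "k0 TYPE(c0) \<le> ereal 7"
    unfolding k0_def
    using sphere_retract_retraction sphere_retract_lipschitz
    by (intro Inf_lower imageI) auto
  also have "ereal 7 \<le> ereal (6 + 4 * sqrt 2)"
    using real_sqrt_ge_one[of 2] by (simp del: real_sqrt_ge_1_iff)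
  finally show ?thesis .
qed

end
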